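(* Let $(p,q)\in(0,1)^2$ with $p+q\neq 1$, let $N\in\mathbb{N}$, and let $L:\mathbb{R}^2\to\mathbb{R}$, $\theta=(e,w)\mapsto L(\theta)$, be the next-token prediction loss (with optimal bias) defined in the context for the stationary binary Markov chain with switching probabilities $p,q$. Then: (i) the set of all global minima of $L$ is $$\Theta_\star(p,q)=\Big\{(e,w)\in\mathbb{R}^2: e^2(1+2w|w|)=\log\tfrac{(1-p)(1-q)}{pq}\Big\};$$ (ii) the set of all local minima of $L$ that are not global minima is $$\Theta_{\min}(p,q)=\{(e,w)\in\mathbb{R}^2: e=0,\ (p+q-1)(1+2w|w|)>0\};$$ (iii) the set of all local maxima of $L$ is $$\Theta_{\max}(p,q)=\{(e,w)\in\mathbb{R}^2: e=0,\ (p+q-1)(1+2w|w|)<0\};$$ (iv) the set of all saddle points of $L$ is $$\Theta_{\mathrm{sad}}(p,q)=\{(0,-1/\sqrt2)\}.$$ Thus the set of all critical points is $$\{\theta\in\mathbb{R}^2:\nabla L(\theta)=0\}=\Theta_\star\cup\Theta_{\min}\cup\Theta_{\max}\cup\Theta_{\mathrm{sad}}.$$ In addition, for any $\theta_\star\in\Theta_\star$, $\theta_{\min}\in\Theta_{\min}$, $\theta_{\max}\in\Theta_{\max}$, $\theta_{\mathrm{sad}}\in\Theta_{\mathrm{sad}}$, $$H(x_{n+1}\mid x_n)=L(\theta_\star)<L(\theta_{\min})=L(\theta_{\max})=L(\theta_{\mathrm{sad}})=H(x_{n+1}).$$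
   Context: Data. $(x_n)_{n\ge1}$ is a $\{0,1\}$-valued time-homogeneous first-order Markov chain with $\mathbb{P}(x_{n+1}=1\mid x_n=0)=p$, $\mathbb{P}(x_{n+1}=0\mid x_n=1)=q$, started from its stationary law $\pi=(\pi_0,\pi_1)=(q,p)/(p+q)$. Entropies use the natural logarithm: $H(x_{n+1}\mid x_n)=\frac{1}{p+q}(q\,h(p)+p\,h(q))$ and $H(x_{n+1})=h(p/(p+q))$, where $h(r)=-r\log r-(1-r)\log(1-r)$; both are constant in $n$. Loss. Let $\ell_{\log}(z)=\log(1+e^{-z})$. For $\theta=(e,w)\in\mathbb{R}^2$ and $b\in\mathbb{R}$ (here $e$ is a real parameter, not Euler's number), $$L(\theta,b)=\frac1N\sum_{n=1}^N\mathbb{E}\Big[\ell_{\log}\Big((2x_{n+1}-1)\big(e^2(1+2w|w|)x_n+b-\tfrac{e^2}{2}\big)\Big)\Big],$$ and $L(\theta)=L(\theta,b_\star(\theta))$ with $b_\star(\theta)=\arg\min_{b\in\mathbb{R}}L(\theta,b)$. Terminology. $\theta$ is a critical (stationary) point if $\nabla L(\theta)=0$. A critical point $\theta_*$ is a local minimum (maximum) if $L(\theta_* )\le L(\theta)$ (resp. $\ge$) for all $\theta$ in some neighborhood of $\theta_*$; a global minimum if the inequality holds on all of $\mathbb{R}^2$; a saddle point if every neighborhood $U$ of it contains $\theta_1,\theta_2\in U$ with $L(\theta_1)<L(\theta_* )<L(\theta_2)$. *)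

theory Defs
  imports "HOL-Probability.Probability"
begin

text \<open>The chain is indexed from 1; the variable \<open>x 0\<close> is unconstrained and never used.
  The Markov property is imposed only on histories of positive probability, because
  \<^const>\<open>cond_prob\<close> is 0 when the conditioning event is null.\<close>

locale stationary_binary_markov_chain = prob_space M
  for M :: "'a measure" +
  fixes x :: "nat \<Rightarrow> 'a \<Rightarrow> real" and p q :: real
  assumes binary: "n \<ge> 1 \<Longrightarrow> x n \<in> M \<rightarrow>\<^sub>M count_space {0, 1}"
    and markov: "n \<ge> 1 \<Longrightarrow> \<P>(\<omega> in M. \<forall>k\<in>{1..n}. x k \<omega> = s k) > 0 \<Longrightarrow>
      \<P>(\<omega> in M. x (n + 1) \<omega> = j \<bar> \<forall>k\<in>{1..n}. x k \<omega> = s k)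
        = \<P>(\<omega> in M. x (n + 1) \<omega> = j \<bar> x n \<omega> = s n)"
    and switch_0_1: "n \<ge> 1 \<Longrightarrow> \<P>(\<omega> in M. x (n + 1) \<omega> = 1 \<bar> x n \<omega> = 0) = p"
    and switch_1_0: "n \<ge> 1 \<Longrightarrow> \<P>(\<omega> in M. x (n + 1) \<omega> = 0 \<bar> x n \<omega> = 1) = q"
    and init_0: "\<P>(\<omega> in M. x 1 \<omega> = 0) = q / (p + q)"
    and init_1: "\<P>(\<omega> in M. x 1 \<omega> = 1) = p / (p + q)"

definition next_entropy :: "'a measure \<Rightarrow> (nat \<Rightarrow> 'a \<Rightarrow> real) \<Rightarrow> nat \<Rightarrow> real" where
  "next_entropy M x n = prob_space.entropy M (exp 1) (count_space {0, 1}) (x (n + 1))"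

definition next_cond_entropy :: "'a measure \<Rightarrow> (nat \<Rightarrow> 'a \<Rightarrow> real) \<Rightarrow> nat \<Rightarrow> real" where
  "next_cond_entropy M x n =
    prob_space.conditional_entropy M (exp 1) (count_space {0, 1}) (count_space {0, 1})
      (x (n + 1)) (x n)"

definition log_loss :: "real \<Rightarrow> real" where
  "log_loss z = ln (1 + exp (- z))"

definition bias_loss ::
  "'a measure \<Rightarrow> (nat \<Rightarrow> 'a \<Rightarrow> real) \<Rightarrow> nat \<Rightarrow> real \<times> real \<Rightarrow> real \<Rightarrow> real" where
  "bias_loss M x N = (\<lambda>(e, w) b. 1 / real N * (\<Sum>n = 1..N. \<integral>\<omega>.
      log_loss ((2 * x (n + 1) \<omega> - 1) * (e\<^sup>2 * (1 + 2 * w * \<bar>w\<bar>) * x n \<omega> + b - e\<^sup>2 / 2)) \<partial>M))"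

definition opt_bias ::
  "'a measure \<Rightarrow> (nat \<Rightarrow> 'a \<Rightarrow> real) \<Rightarrow> nat \<Rightarrow> real \<times> real \<Rightarrow> real" where
  "opt_bias M x N \<theta> = arg_min (bias_loss M x N \<theta>) (\<lambda>_. True)"

definition loss :: "'a measure \<Rightarrow> (nat \<Rightarrow> 'a \<Rightarrow> real) \<Rightarrow> nat \<Rightarrow> real \<times> real \<Rightarrow> real" where
  "loss M x N \<theta> = bias_loss M x N \<theta> (opt_bias M x N \<theta>)"

definition critical_point :: "('b::real_inner \<Rightarrow> real) \<Rightarrow> 'b \<Rightarrow> bool" where
  "critical_point L \<theta> \<longleftrightarrow> GDERIV L \<theta> :> 0"

definition local_minimum :: "('b::real_inner \<Rightarrow> real) \<Rightarrow> 'b \<Rightarrow> bool" where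
  "local_minimum L \<theta> \<longleftrightarrow> critical_point L \<theta> \<and> (\<forall>\<^sub>F \<theta>' in nhds \<theta>. L \<theta> \<le> L \<theta>')"

definition local_maximum :: "('b::real_inner \<Rightarrow> real) \<Rightarrow> 'b \<Rightarrow> bool" where
  "local_maximum L \<theta> \<longleftrightarrow> critical_point L \<theta> \<and> (\<forall>\<^sub>F \<theta>' in nhds \<theta>. L \<theta> \<ge> L \<theta>')"

definition global_minimum :: "('b::real_inner \<Rightarrow> real) \<Rightarrow> 'b \<Rightarrow> bool" where
  "global_minimum L \<theta> \<longleftrightarrow> critical_point L \<theta> \<and> (\<forall>\<theta>'. L \<theta> \<le> L \<theta>')"

definition saddle_point :: "('b::real_inner \<Rightarrow> real) \<Rightarrow> 'b \<Rightarrow> bool" where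
  "saddle_point L \<theta> \<longleftrightarrow> critical_point L \<theta> \<and>
    (\<forall>U. open U \<and> \<theta> \<in> U \<longrightarrow> (\<exists>\<theta>1\<in>U. \<exists>\<theta>2\<in>U. L \<theta>1 < L \<theta> \<and> L \<theta> < L \<theta>2))"

definition Theta_star :: "real \<Rightarrow> real \<Rightarrow> (real \<times> real) set" where
  "Theta_star p q = {(e, w). e\<^sup>2 * (1 + 2 * w * \<bar>w\<bar>) = ln ((1 - p) * (1 - q) / (p * q))}"

definition Theta_min :: "real \<Rightarrow> real \<Rightarrow> (real \<times> real) set" where
  "Theta_min p q = {(e, w). e = 0 \<and> (p + q - 1) * (1 + 2 * w * \<bar>w\<bar>) > 0}"

definition Theta_max :: "real \<Rightarrow> real \<Rightarrow> (real \<times> real) set" where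
  "Theta_max p q = {(e, w). e = 0 \<and> (p + q - 1) * (1 + 2 * w * \<bar>w\<bar>) < 0}"

definition Theta_sad :: "real \<Rightarrow> real \<Rightarrow> (real \<times> real) set" where
  "Theta_sad p q = {(0, - 1 / sqrt 2)}"

end

theory Submission
  imports Defs
begin

text \<open>
  The loss depends on \<open>(e, w)\<close> only through the coefficient \<open>y = e\<^sup>2 (1 + 2 w \<bar>w\<bar>)\<close>. As a function of
  \<open>y\<close>, the loss minimized over the bias is differentiable, by an explicit optimal bias (the positive root
  of a quadratic for \<open>exp c\<close>); by the envelope identity its derivative has the sign of
  \<open>y - ln ((1 - p) (1 - q) / (p q))\<close>. The critical points are therefore the points where \<open>y\<close> hits the bottom
  of this valley and those where \<open>\<nabla>y = 0\<close>, that is \<open>e = 0\<close>. Near \<open>(0, w)\<close> the sign of \<open>y\<close> is that of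
  \<open>1 + 2 w \<bar>w\<bar>\<close>, and comparing it with the side on which the bottom lies gives the type of the point.
\<close>

section \<open>Composing a one-dimensional valley with the coefficient map\<close>

lemma mult_abs_strict_mono:
  fixes u v :: real
  assumes "u < v"
  shows "u * \<bar>u\<bar> < v * \<bar>v\<bar>"
proof -
  have "u * u < v * v" if "0 \<le> u"
    using that assms by (intro mult_strict_mono) auto
  moreover have "v * v < u * u" if "v \<le> 0"
    using mult_strict_mono[of "- v" "- u" "- v" "- u"] that assms by auto
  moreover have "u * u > 0" if "u < 0"
    using that by (simp add: mult_neg_neg)
  moreover have "v * v > 0" if "v > 0"
    using that by simp
  ultimately show ?thesis
    using assms by (cases "0 \<le> u"; cases "v \<le> 0"; smt (verit, best) mult_minus_right)
qed

text \<open>The factor \<open>w\<close> smooths the kink of \<open>\<bar>w\<bar>\<close> at 0, so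
  \<open>coupling\<close> has a gradient everywhere.\<close>

lemma DERIV_mult_abs: "DERIV (\<lambda>w::real. w * \<bar>w\<bar>) w :> 2 * \<bar>w\<bar>"
proof -
  consider "w > 0" | "w < 0" | "w = 0" by linarith
  then show ?thesis
  proof cases
    case 1
    have "DERIV (\<lambda>w. w * w) w :> 2 * \<bar>w\<bar>"
      using 1 by (auto intro!: derivative_eq_intros)
    then show ?thesis
      by (rule has_field_derivative_transform_within_open[of _ _ _ "{0<..}"]) (use 1 in auto)
  next
    case 2
    have "DERIV (\<lambda>w. - (w * w)) w :> 2 * \<bar>w\<bar>"
      using 2 by (auto intro!: derivative_eq_intros)
    then show ?thesis
      by (rule has_field_derivative_transform_within_open[of _ _ _ "{..<0}"]) (use 2 in auto)
  next
    case 3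
    \<comment> \<open>At 0 the difference quotient is \<open>\<bar>h\<bar>\<close> itself.\<close>
    have "(\<lambda>h::real. \<bar>h\<bar>) \<midarrow>0\<rightarrow> \<bar>0\<bar>"
      by (intro tendsto_intros)
    then have "(\<lambda>h::real. h * \<bar>h\<bar> / h) \<midarrow>0\<rightarrow> \<bar>0\<bar>"
      by (rule Lim_transform_eventually) (auto simp: eventually_at_filter)
    then show ?thesis
      using 3 by (simp add: DERIV_def)
  qed
qed

definition gain :: "real \<Rightarrow> real" where
  "gain w = 1 + 2 * w * \<bar>w\<bar>"

lemma gain_strict_mono: "u < v \<Longrightarrow> gain u < gain v"
  using mult_abs_strict_mono[of u v] by (simp add: gain_def)

lemma gain_zero: "gain (- 1 / sqrt 2) = 0"
  by (simp add: gain_def)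

lemma gain_eq_0_iff: "gain w = 0 \<longleftrightarrow> w = - 1 / sqrt 2"
  using gain_strict_mono[of w "- 1 / sqrt 2"] gain_strict_mono[of "- 1 / sqrt 2" w] gain_zero
  by (metis less_irrefl linorder_less_linear)

definition coupling :: "real \<times> real \<Rightarrow> real" where
  "coupling = (\<lambda>(e, w). e\<^sup>2 * gain w)"

lemma coupling_axis [simp]: "coupling (0, w) = 0"
  by (simp add: coupling_def)

lemma GDERIV_coupling:
  "GDERIV coupling (e, w) :> (2 * e * gain w, 4 * e\<^sup>2 * \<bar>w\<bar>)"
proof -
  have g: "DERIV gain w :> 4 * \<bar>w\<bar>"
    unfolding gain_def mult.assoc
    by (rule derivative_eq_intros DERIV_mult_abs refl)+ simp
  have "((\<lambda>z. gain (snd z)) has_derivative (\<lambda>h. (4 * \<bar>w\<bar>) * snd h)) (at (e, w))"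
    by (rule has_derivative_compose[of snd snd "(e, w)" UNIV gain, simplified])
       (use g in \<open>auto simp: has_field_derivative_def intro!: has_derivative_snd has_derivative_ident\<close>)
  then have "((\<lambda>z. (fst z)\<^sup>2 * gain (snd z)) has_derivative
    (\<lambda>h. h \<bullet> (2 * e * gain w, 4 * e\<^sup>2 * \<bar>w\<bar>))) (at (e, w))"
    by (auto intro!: derivative_eq_intros simp: inner_prod_def algebra_simps)
  then show ?thesis
    by (simp add: gderiv_def coupling_def case_prod_unfold)
qed

section \<open>Uniqueness of gradients and disjointness of saddles and extrema\<close>

lemma GDERIV_unique: "GDERIV f x :> d \<Longrightarrow> GDERIV f x :> d' \<Longrightarrow> d = d'"
  unfolding gderiv_def
  by (metis has_derivative_unique inner_commute vector_eq_ldot)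

lemma saddle_not_extremum:
  assumes "saddle_point L \<theta>"
  shows "\<not> local_minimum L \<theta>" "\<not> local_maximum L \<theta>"
  using assms unfolding saddle_point_def local_minimum_def local_maximum_def eventually_nhds
  by (meson not_le)+

text \<open>Only the sign pattern of the derivative enters the classification.
  \<open>bottom_nonzero\<close> keeps the axis \<open>e = 0\<close>, where \<open>coupling\<close>
  is 0, away from the bottom.\<close>

locale valley =
  fixes G G' :: "real \<Rightarrow> real" and a :: real
  assumes deriv: "DERIV G y :> G' y"
    and deriv_neg: "y < a \<Longrightarrow> G' y < 0"
    and deriv_pos: "a < y \<Longrightarrow> 0 < G' y"
    and bottom_nonzero: "a \<noteq> 0"
begin

abbreviation L :: "real \<times> real \<Rightarrow> real" where
  "L \<theta> \<equiv> G (coupling \<theta>)"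

lemma continuous_on_G: "continuous_on S G"
  using deriv by (rule DERIV_continuous_on[OF has_field_derivative_at_within])

lemma strict_decreasing:
  assumes "y < z" "z \<le> a"
  shows "G z < G y"
proof (rule DERIV_neg_imp_decreasing_open[OF assms(1) _ continuous_on_G])
  fix t assume "y < t" "t < z"
  then show "\<exists>d. DERIV G t :> d \<and> d < 0"
    using deriv[of t] deriv_neg[of t] assms by auto
qed

lemma strict_increasing:
  assumes "a \<le> y" "y < z"
  shows "G y < G z"
proof (rule DERIV_pos_imp_increasing_open[OF assms(2) _ continuous_on_G])
  fix t assume "y < t" "t < z"
  then show "\<exists>d. DERIV G t :> d \<and> 0 < d"
    using deriv[of t] deriv_pos[of t] assms by auto
qed

lemma bottom_less: "y \<noteq> a \<Longrightarrow> G a < G y"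
  using strict_decreasing[of y a] strict_increasing[of a y] by linarith

lemma bottom_le: "G a \<le> G y"
  using bottom_less[of y] by (cases "y = a") auto

text \<open>The sign condition puts \<open>y\<close> on the side of 0 where the bottom lies; the
  bound keeps it from overshooting \<open>a\<close>.\<close>

lemma less_G_0:
  assumes "0 < a * y" "\<bar>y\<bar> < \<bar>a\<bar>"
  shows "G y < G 0"
  using assms strict_decreasing[of 0 y] strict_increasing[of y 0] by (auto simp: zero_less_mult_iff)

text \<open>Moving away from the bottom climbs at any distance, in contrast to
  \<open>less_G_0\<close>.\<close>

lemma G_0_less: "a * y < 0 \<Longrightarrow> G 0 < G y"
  using strict_decreasing[of y 0] strict_increasing[of 0 y] by (auto simp: mult_less_0_iff)

lemma deriv_eq_0_iff: "G' y = 0 \<longleftrightarrow> y = a"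
proof
  show "G' y = 0 \<Longrightarrow> y = a" using deriv_neg[of y] deriv_pos[of y] by force
  \<comment> \<open>The sign hypotheses leave \<open>a\<close> itself open; there the derivative
    vanishes because \<open>a\<close> is a minimum. The radius 1 is arbitrary.\<close>
  have "G' a = 0" using DERIV_local_min[OF deriv, of 1 a] bottom_le by simp
  then show "y = a \<Longrightarrow> G' y = 0" by simp
qed

text \<open>By the chain rule the gradient is the scalar \<open>G' (coupling (e, w))\<close> times
  the gradient of \<open>coupling\<close>, so one of the two must vanish.\<close>

lemma critical_point_iff: "critical_point L (e, w) \<longleftrightarrow> coupling (e, w) = a \<or> e = 0"
proof -
  have D: "GDERIV L (e, w) :> G' (coupling (e, w)) *\<^sub>R (2 * e * gain w, 4 * e\<^sup>2 * \<bar>w\<bar>)"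
    by (rule GDERIV_DERIV_compose[OF GDERIV_coupling deriv])
  then have "critical_point L (e, w) \<longleftrightarrow>
      G' (coupling (e, w)) *\<^sub>R (2 * e * gain w, 4 * e\<^sup>2 * \<bar>w\<bar>) = 0"
    unfolding critical_point_def by (metis GDERIV_unique)
  \<comment> \<open>For \<open>e \<noteq> 0\<close> the gradient of \<open>coupling\<close> is
    nonzero: its second component would force \<open>w = 0\<close>, but
    \<open>gain 0 = 1\<close>.\<close>
  also have "\<dots> \<longleftrightarrow> coupling (e, w) = a \<or> e = 0"
    by (auto simp: deriv_eq_0_iff zero_prod_def gain_def)
  finally show ?thesis .
qed

text \<open>Stepping off the axis with a small \<open>e > 0\<close> gives \<open>coupling\<close>
  the sign of \<open>gain w\<close>. Smallness serves the second claim, where the step must not jump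
  past the bottom.\<close>

lemma escape:
  assumes "open U" "(0, w) \<in> U"
  shows "a * gain w < 0 \<Longrightarrow> \<exists>\<theta>\<in>U. G 0 < L \<theta>"
    and "0 < a * gain w \<Longrightarrow> \<exists>\<theta>\<in>U. L \<theta> < G 0"
proof -
  have "((\<lambda>e. (e, w)) \<longlongrightarrow> (0, w)) (at_right 0)"
    by (intro tendsto_intros)
  then have U: "\<forall>\<^sub>F e in at_right 0. (e, w) \<in> U"
    using assms by (rule topological_tendstoD)
  have pos: "\<forall>\<^sub>F e::real in at_right 0. 0 < e"
    by (auto simp: eventually_at_filter)
  have "((\<lambda>e. \<bar>coupling (e, w)\<bar>) \<longlongrightarrow> \<bar>coupling (0, w)\<bar>) (at_right 0)"
    unfolding coupling_def prod.case by (intro tendsto_intros)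
  then have small: "\<forall>\<^sub>F e in at_right 0. \<bar>coupling (e, w)\<bar> < \<bar>a\<bar>"
    by (rule order_tendstoD) (use bottom_nonzero in auto)
  obtain e where e: "(e, w) \<in> U" "0 < e" "\<bar>coupling (e, w)\<bar> < \<bar>a\<bar>"
    using eventually_happens'[OF _ eventually_conj[OF U eventually_conj[OF pos small]]] by auto
  have eq: "a * coupling (e, w) = e\<^sup>2 * (a * gain w)"
    by (simp add: coupling_def)
  have "a * coupling (e, w) < 0" if "a * gain w < 0"
    unfolding eq by (rule mult_pos_neg) (use that e(2) in auto)
  then show "a * gain w < 0 \<Longrightarrow> \<exists>\<theta>\<in>U. G 0 < L \<theta>"
    using e(1) G_0_less by blast
  have "0 < a * coupling (e, w)" if "0 < a * gain w"
    unfolding eq by (rule mult_pos_pos) (use that e(2) in auto)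
  then show "0 < a * gain w \<Longrightarrow> \<exists>\<theta>\<in>U. L \<theta> < G 0"
    using e less_G_0 by blast
qed

lemma eventually_gain_sign:
  assumes "0 < c * gain w"
  shows "\<forall>\<^sub>F \<theta> in nhds (e, w). 0 < c * gain (snd \<theta>)"
proof -
  have "((\<lambda>\<theta>. c * gain (snd \<theta>)) \<longlongrightarrow> c * gain (snd (e, w))) (nhds (e, w))"
    unfolding gain_def by (intro tendsto_intros filterlim_ident)
  then show ?thesis
    by (rule order_tendstoD) (use assms in auto)
qed

text \<open>\<open>gain\<close> keeps its sign for nearby \<open>w\<close>. Over such
  \<open>w\<close>, every \<open>e \<noteq> 0\<close> moves away from the bottom, and
  \<open>e = 0\<close> stays at level \<open>G 0\<close>.\<close>

lemma local_minimum_axis: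
  assumes "a * gain w < 0"
  shows "local_minimum L (0, w)"
proof -
  have "L (0, w) \<le> L \<theta>" if "0 < - a * gain (snd \<theta>)" for \<theta>
  proof (cases "fst \<theta> = 0")
    case False
    have "a * coupling \<theta> = (fst \<theta>)\<^sup>2 * (a * gain (snd \<theta>))"
      by (simp add: coupling_def case_prod_beta)
    also have "\<dots> < 0" by (rule mult_pos_neg) (use that False in auto)
    finally show ?thesis using G_0_less by (simp add: less_imp_le)
  qed (cases \<theta>, simp)
  then show ?thesis
    using eventually_gain_sign[of "- a" w 0] assms
    by (auto simp: local_minimum_def critical_point_iff elim: eventually_mono)
qed

lemma local_maximum_axis:
  assumes "0 < a * gain w"
  shows "local_maximum L (0, w)"
proof -
  \<comment> \<open>A move towards the bottom is sure to lower the loss only if it does not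
    overshoot, so the neighborhood must also keep \<open>coupling\<close> small.\<close>
  have "((\<lambda>\<theta>. \<bar>coupling \<theta>\<bar>) \<longlongrightarrow> \<bar>coupling (0, w)\<bar>) (nhds (0, w))"
    unfolding coupling_def gain_def case_prod_beta by (intro tendsto_intros filterlim_ident)
  then have small: "\<forall>\<^sub>F \<theta> in nhds (0, w). \<bar>coupling \<theta>\<bar> < \<bar>a\<bar>"
    by (rule order_tendstoD) (use bottom_nonzero in auto)
  have "L \<theta> \<le> L (0, w)" if "0 < a * gain (snd \<theta>)" "\<bar>coupling \<theta>\<bar> < \<bar>a\<bar>" for \<theta>
  proof (cases "fst \<theta> = 0")
    case False
    have "0 < (fst \<theta>)\<^sup>2 * (a * gain (snd \<theta>))" by (rule mult_pos_pos) (use that False in auto)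
    also have "\<dots> = a * coupling \<theta>"
      by (simp add: coupling_def case_prod_beta)
    finally show ?thesis using less_G_0 that by (simp add: less_imp_le)
  qed (cases \<theta>, simp)
  then show ?thesis
    using eventually_conj[OF eventually_gain_sign[of a w 0] small] assms
    by (auto simp: local_maximum_def critical_point_iff elim!: eventually_mono)
qed

text \<open>The whole axis lies at level \<open>G 0\<close>, and \<open>gain\<close> changes sign at
  \<open>w\<close>. Axis points just right and just left of \<open>w\<close> therefore allow escapes
  in opposite directions.\<close>

lemma saddle_point_axis:
  assumes "gain w = 0"
  shows "saddle_point L (0, w)"
  unfolding saddle_point_def
proof (intro conjI allI impI)
  show "critical_point L (0, w)" by (simp add: critical_point_iff)
next
  fix U :: "(real \<times> real) set" assume U: "open U \<and> (0, w) \<in> U"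
  have "((\<lambda>v. (0, v)) \<longlongrightarrow> (0::real, w)) (at_right w)" "((\<lambda>v. (0, v)) \<longlongrightarrow> (0::real, w)) (at_left w)"
    by (intro tendsto_intros)+
  then have "\<forall>\<^sub>F v in at_right w. (0, v) \<in> U \<and> w < v" "\<forall>\<^sub>F v in at_left w. (0, v) \<in> U \<and> v < w"
    using U by (auto intro!: eventually_conj dest: topological_tendstoD simp: eventually_at_filter)
  then obtain v1 v2 where v: "(0, v1) \<in> U" "w < v1" "(0, v2) \<in> U" "v2 < w"
    using eventually_happens'[of "at_right w"] eventually_happens'[of "at_left w"] by fastforce
  have "0 < gain v1" "gain v2 < 0"
    using gain_strict_mono[of w v1] gain_strict_mono[of v2 w] v assms by auto
  then have "(a * gain v1 < 0 \<and> 0 < a * gain v2) \<or> (a * gain v2 < 0 \<and> 0 < a * gain v1)"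
    using bottom_nonzero by (auto simp: zero_less_mult_iff mult_less_0_iff)
  \<comment> \<open>\<open>escape\<close> is applied at \<open>(0, v1)\<close> and
    \<open>(0, v2)\<close>; at \<open>(0, w)\<close> neither of its sign conditions holds.\<close>
  then have "(\<exists>\<theta>\<in>U. G 0 < L \<theta>) \<and> (\<exists>\<theta>\<in>U. L \<theta> < G 0)"
    using escape[of U] U v by blast
  then show "\<exists>\<theta>1\<in>U. \<exists>\<theta>2\<in>U. L \<theta>1 < L (0, w) \<and> L (0, w) < L \<theta>2"
    by auto
qed

text \<open>\<open>gain 0 = 1\<close> and \<open>gain (- 1) = - 1\<close>, so both signs of
  \<open>a\<close> are reached.\<close>

lemma bottom_attained: "\<exists>\<theta>. coupling \<theta> = a"
proof (cases "0 < a")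
  case True
  then have "coupling (sqrt a, 0) = a" by (simp add: coupling_def gain_def)
  then show ?thesis ..
next
  case False
  then have "coupling (sqrt (- a), - 1) = a" by (simp add: coupling_def gain_def)
  then show ?thesis ..
qed

lemma global_minimum_iff: "global_minimum L \<theta> \<longleftrightarrow> coupling \<theta> = a"
proof
  assume "global_minimum L \<theta>"
  moreover obtain \<theta>' where "coupling \<theta>' = a" using bottom_attained ..
  ultimately have "L \<theta> \<le> G a" unfolding global_minimum_def by metis
  then show "coupling \<theta> = a" using bottom_less[of "coupling \<theta>"] by fastforce
next
  assume "coupling \<theta> = a"
  then show "global_minimum L \<theta>"
    using bottom_le by (cases \<theta>) (auto simp: global_minimum_def critical_point_iff)
qed

text \<open>Off the axis, increasing \<open>w\<close> alone changes \<open>coupling\<close>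
  strictly, so the loss exceeds its bottom value arbitrarily nearby.\<close>

lemma bottom_not_local_maximum:
  assumes "coupling (e, w) = a"
  shows "\<not> local_maximum L (e, w)"
proof
  assume "local_maximum L (e, w)"
  then have ev: "\<forall>\<^sub>F \<theta> in nhds (e, w). L \<theta> \<le> L (e, w)"
    by (simp add: local_maximum_def)
  have "((\<lambda>v. (e, v)) \<longlongrightarrow> (e, w)) (at_right w)"
    by (intro tendsto_intros)
  then have "\<forall>\<^sub>F v in at_right w. L (e, v) \<le> L (e, w)"
    using ev by (rule eventually_compose_filterlim[rotated])
  then have "\<forall>\<^sub>F v in at_right w. L (e, v) \<le> L (e, w) \<and> w < v"
    by (auto intro!: eventually_conj simp: eventually_at_filter)
  then obtain v where v: "L (e, v) \<le> L (e, w)" "w < v"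
    using eventually_happens'[of "at_right w"] by fastforce
  have "e \<noteq> 0" using assms bottom_nonzero by auto
  then have "coupling (e, v) \<noteq> a"
    using assms gain_strict_mono[OF v(2)] by (auto simp: coupling_def)
  then show False using bottom_less v(1) assms by fastforce
qed

text \<open>\<open>escape\<close> refutes the opposite extremum, and saddles are never extrema. The
  three characterizations below take their axis case from here.\<close>

lemma axis_cases:
  obtains "a * gain w < 0" "local_minimum L (0, w)" "\<not> local_maximum L (0, w)" "\<not> saddle_point L (0, w)"
  | "0 < a * gain w" "local_maximum L (0, w)" "\<not> local_minimum L (0, w)" "\<not> saddle_point L (0, w)"
  | "gain w = 0" "saddle_point L (0, w)" "\<not> local_minimum L (0, w)" "\<not> local_maximum L (0, w)"
proof -
  consider "a * gain w < 0" | "0 < a * gain w" | "gain w = 0"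
    using bottom_nonzero by (metis linorder_less_linear mult_eq_0_iff)
  then show thesis
  proof cases
    case 1
    then have "\<not> local_maximum L (0, w)"
      using escape(1)[of _ w] unfolding local_maximum_def eventually_nhds
      by (metis coupling_axis not_le)
    then show thesis
      using that(1) 1 local_minimum_axis saddle_not_extremum(1) by blast
  next
    case 2
    then have "\<not> local_minimum L (0, w)"
      using escape(2)[of _ w] unfolding local_minimum_def eventually_nhds
      by (metis coupling_axis not_le)
    then show thesis
      using that(2) 2 local_maximum_axis saddle_not_extremum(2) by blast
  next
    case 3
    then show thesis
      using that(3) saddle_point_axis saddle_not_extremum by blast
  qed
qed

lemma bottom_local_minimum: "coupling \<theta> = a \<Longrightarrow> local_minimum L \<theta>"
  using global_minimum_iff[of \<theta>] unfolding global_minimum_def local_minimum_def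
  by (blast intro: always_eventually)

lemma local_minimum_iff:
  "local_minimum L (e, w) \<and> \<not> global_minimum L (e, w) \<longleftrightarrow> e = 0 \<and> a * gain w < 0"
proof (cases "e = 0")
  case True
  then show ?thesis
    \<comment> \<open>On the axis \<open>coupling\<close> is 0, which differs from \<open>a\<close>,
      so no axis point is a global minimum.\<close>
    by (cases rule: axis_cases[of w]) (use True bottom_nonzero in \<open>simp_all add: global_minimum_iff\<close>)
next
  case False
  then show ?thesis by (auto simp: local_minimum_def global_minimum_iff critical_point_iff)
qed

lemma local_maximum_iff: "local_maximum L (e, w) \<longleftrightarrow> e = 0 \<and> 0 < a * gain w"
proof (cases "e = 0")
  case True
  then show ?thesis by (cases rule: axis_cases[of w]) (use True in simp_all)
next
  case False
  then show ?thesis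
    using bottom_not_local_maximum by (auto simp: local_maximum_def critical_point_iff)
qed

text \<open>A critical point off the axis sits at the bottom, hence is a local minimum and no
  saddle.\<close>

lemma saddle_point_iff: "saddle_point L (e, w) \<longleftrightarrow> e = 0 \<and> gain w = 0"
proof (cases "e = 0")
  case True
  then show ?thesis by (cases rule: axis_cases[of w]) (use True in auto)
next
  case False
  then have "\<not> saddle_point L (e, w)"
    by (metis critical_point_iff bottom_local_minimum saddle_not_extremum(1) saddle_point_def)
  then show ?thesis using False by simp
qed

end

section \<open>The loss as a function of the coefficient and the bias\<close>

definition sigmoid :: "real \<Rightarrow> real" where
  "sigmoid u = 1 / (1 + exp (- u))"

definition logit :: "real \<Rightarrow> real" where
  "logit r = ln (r / (1 - r))"

definition binary_entropy :: "real \<Rightarrow> real" where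
  "binary_entropy r = - r * ln r - (1 - r) * ln (1 - r)"

text \<open>Cross-entropy between a label that is 1 with probability \<open>r\<close> and the
  prediction \<open>sigmoid u\<close>.\<close>

definition bernoulli_loss :: "real \<Rightarrow> real \<Rightarrow> real" where
  "bernoulli_loss r u = r * log_loss u + (1 - r) * log_loss (- u)"

lemma sigmoid_strict_mono: "u < v \<Longrightarrow> sigmoid u < sigmoid v"
  unfolding sigmoid_def by (intro divide_strict_left_mono) (auto intro!: add_pos_pos mult_pos_pos)

lemma sigmoid_less_iff: "sigmoid u < sigmoid v \<longleftrightarrow> u < v"
  using sigmoid_strict_mono by (metis less_asym linorder_neqE)

lemma sigmoid_logit:
  assumes "0 < r" "r < 1"
  shows "sigmoid (logit r) = r"
  using assms by (simp add: sigmoid_def logit_def exp_minus field_simps)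

lemma sigmoid_ln: "0 < r \<Longrightarrow> sigmoid (ln r) = r / (1 + r)"
  by (simp add: sigmoid_def exp_minus field_simps)

lemma DERIV_bernoulli_loss: "DERIV (bernoulli_loss r) u :> sigmoid u - r"
proof -
  have pos: "0 < 1 + exp (- u)" "0 < 1 + exp u"
    by (simp_all add: add_pos_pos)
  have "DERIV (bernoulli_loss r) u :>
      r * (- exp (- u) / (1 + exp (- u))) + (1 - r) * (exp u / (1 + exp u))"
    unfolding bernoulli_loss_def log_loss_def using pos
    by (auto intro!: derivative_eq_intros simp: add_pos_pos mult.commute)
  also have "exp u / (1 + exp u) = sigmoid u"
    using pos by (simp add: sigmoid_def exp_minus field_simps)
  also have "- exp (- u) / (1 + exp (- u)) = sigmoid u - 1"
    using pos by (simp add: sigmoid_def field_simps)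
  finally show ?thesis by (simp add: algebra_simps)
qed

text \<open>At the score \<open>logit r\<close> the predicted probability is exactly
  \<open>r\<close>, so cross-entropy becomes entropy.\<close>

lemma bernoulli_loss_logit:
  assumes "0 < r" "r < 1"
  shows "bernoulli_loss r (logit r) = binary_entropy r"
proof -
  have e: "exp (logit r) = r / (1 - r)" using assms by (simp add: logit_def)
  have "log_loss (logit r) = ln (1 / r)" "log_loss (- logit r) = ln (1 / (1 - r))"
    unfolding log_loss_def exp_minus minus_minus e using assms
    by (auto intro!: arg_cong[where f = ln] simp: field_simps)
  then show ?thesis
    using assms by (simp add: bernoulli_loss_def binary_entropy_def ln_div)
qed

lemma binary_entropy_flip: "binary_entropy (1 - r) = binary_entropy r"
  by (simp add: binary_entropy_def algebra_simps)

section \<open>Optimal bias and reduced loss\<close>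

locale chain_parameters =
  fixes p q :: real
  assumes p_pos: "0 < p" and p_less: "p < 1" and q_pos: "0 < q" and q_less: "q < 1"
begin

lemmas bounds = p_pos p_less q_pos q_less

text \<open>The weights are the stationary ones. From state 0 the score is \<open>c\<close> and a 1
  follows with probability \<open>p\<close>; from state 1 these are \<open>y + c\<close> and
  \<open>1 - q\<close>. Here \<open>c\<close> stands for \<open>b - e\<^sup>2 / 2\<close>.\<close>

definition chain_loss :: "real \<Rightarrow> real \<Rightarrow> real" where
  "chain_loss y c = (q * bernoulli_loss p c + p * bernoulli_loss (1 - q) (y + c)) / (p + q)"

text \<open>First-order condition in \<open>c\<close>. Divided by \<open>p + q\<close>, it equates
  the mean predicted probability of a 1 with the stationary one.\<close>

definition stationary_bias :: "real \<Rightarrow> real \<Rightarrow> bool" where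
  "stationary_bias y c \<longleftrightarrow> q * sigmoid c + p * sigmoid (y + c) = p"

lemma DERIV_chain_loss:
  "DERIV (chain_loss y) c :> (q * sigmoid c + p * sigmoid (y + c) - p) / (p + q)"
proof -
  have "DERIV (\<lambda>c. bernoulli_loss (1 - q) (y + c)) c :> (sigmoid (y + c) - (1 - q)) * 1"
    by (rule DERIV_chain2[OF DERIV_bernoulli_loss]) (auto intro!: derivative_eq_intros)
  from DERIV_cdivide[OF DERIV_add[OF DERIV_cmult[OF DERIV_bernoulli_loss[of p c], of q]
      DERIV_cmult[OF this, of p]], of "p + q"]
  show ?thesis
    unfolding chain_loss_def by (simp add: algebra_simps)
qed

text \<open>The derivative in the bias increases because \<open>sigmoid\<close> does, so a zero of
  it separates descent from ascent.\<close>

lemma stationary_bias_minimizes: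
  assumes "stationary_bias y c"
  shows "chain_loss y c \<le> chain_loss y c'"
proof -
  have s: "(q * sigmoid t + p * sigmoid (y + t) - p) / (p + q) \<ge> 0" if "c \<le> t" for t
  proof -
    have "sigmoid c \<le> sigmoid t" "sigmoid (y + c) \<le> sigmoid (y + t)"
      using that by (simp_all add: sigmoid_less_iff flip: not_less)
    then have "q * sigmoid c + p * sigmoid (y + c) \<le> q * sigmoid t + p * sigmoid (y + t)"
      using bounds by (intro add_mono mult_left_mono) auto
    then show ?thesis using assms bounds by (simp add: stationary_bias_def)
  qed
  have s': "(q * sigmoid t + p * sigmoid (y + t) - p) / (p + q) \<le> 0" if "t \<le> c" for t
  proof -
    have "sigmoid t \<le> sigmoid c" "sigmoid (y + t) \<le> sigmoid (y + c)"
      using that by (simp_all add: sigmoid_less_iff flip: not_less)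
    then have "q * sigmoid t + p * sigmoid (y + t) \<le> q * sigmoid c + p * sigmoid (y + c)"
      using bounds by (intro add_mono mult_left_mono) auto
    then show ?thesis using assms bounds by (simp add: stationary_bias_def divide_nonpos_pos)
  qed
  show ?thesis
  proof (cases "c \<le> c'")
    case True
    show ?thesis
      by (rule DERIV_nonneg_imp_nondecreasing[OF True]) (use DERIV_chain_loss s in blast)
  next
    case False
    then have "c' \<le> c" by simp
    then show ?thesis
      by (rule DERIV_nonpos_imp_nonincreasing) (use DERIV_chain_loss s' in blast)
  qed
qed

text \<open>With \<open>r = exp c\<close>, clearing denominators in
  \<open>stationary_bias y c\<close> gives
  \<open>q * exp y * r\<^sup>2 + (q - p) * r - p = 0\<close>; this is the positive root.\<close>

definition opt_odds :: "real \<Rightarrow> real" where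
  "opt_odds y = (p - q + sqrt ((p - q)\<^sup>2 + 4 * p * q * exp y)) / (2 * q * exp y)"

lemma opt_odds_pos: "0 < opt_odds y"
proof -
  have "\<bar>p - q\<bar> = sqrt ((p - q)\<^sup>2)" by simp
  also have "\<dots> < sqrt ((p - q)\<^sup>2 + 4 * p * q * exp y)"
    using bounds by (intro real_sqrt_less_mono) simp
  finally have "0 < p - q + sqrt ((p - q)\<^sup>2 + 4 * p * q * exp y)" by linarith
  then show ?thesis
    using bounds unfolding opt_odds_def by (intro divide_pos_pos) auto
qed

lemma opt_odds_root: "q * exp y * (opt_odds y)\<^sup>2 + (q - p) * opt_odds y - p = 0"
proof -
  define D where "D = sqrt ((p - q)\<^sup>2 + 4 * p * q * exp y)"
  have D: "D\<^sup>2 = (p - q)\<^sup>2 + 4 * p * q * exp y"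
    unfolding D_def using bounds by (intro real_sqrt_pow2) (auto intro!: add_nonneg_nonneg)
  have eq: "2 * q * exp y * opt_odds y = p - q + D"
    using bounds by (simp add: opt_odds_def D_def)
  \<comment> \<open>The factor \<open>4 * q * exp y\<close> prepares completing the square.\<close>
  have "4 * q * exp y * (q * exp y * (opt_odds y)\<^sup>2 + (q - p) * opt_odds y - p)
      = (2 * q * exp y * opt_odds y)\<^sup>2 + 2 * (q - p) * (2 * q * exp y * opt_odds y) - 4 * p * q * exp y"
    by (simp add: algebra_simps power2_eq_square)
  also have "\<dots> = 0"
    unfolding eq using D by (simp add: algebra_simps power2_eq_square)
  finally show ?thesis using bounds by simp
qed

definition opt_logit :: "real \<Rightarrow> real" where
  "opt_logit y = ln (opt_odds y)"

lemma stationary_opt_logit: "stationary_bias y (opt_logit y)"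
proof -
  define r where "r = opt_odds y"
  define a where "a = exp y"
  have pos: "0 < r" "0 < a" "0 < 1 + r" "0 < 1 + a * r"
    using opt_odds_pos by (auto simp: r_def a_def intro!: add_pos_pos)
  have root: "q * a * r\<^sup>2 + (q - p) * r - p = 0"
    using opt_odds_root by (simp add: r_def a_def)
  have "y + opt_logit y = ln (a * r)"
    using pos by (simp add: ln_mult opt_logit_def r_def a_def)
  then have "sigmoid (y + opt_logit y) = a * r / (1 + a * r)"
    using pos by (simp add: sigmoid_ln)
  moreover have "sigmoid (opt_logit y) = r / (1 + r)"
    using pos by (simp add: sigmoid_ln opt_logit_def r_def)
  \<comment> \<open>Over the common denominator, the first-order condition has the quadratic as its
    numerator.\<close>
  moreover have "q * (r / (1 + r)) + p * (a * r / (1 + a * r)) - p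
      = (q * a * r\<^sup>2 + (q - p) * r - p) / ((1 + r) * (1 + a * r))"
    using pos by (simp add: divide_simps) (simp add: algebra_simps power2_eq_square)
  ultimately show ?thesis
    using root by (simp add: stationary_bias_def)
qed

text \<open>Existence suffices: the value of this derivative cancels in the envelope
  identity.\<close>

lemma opt_logit_differentiable: "\<exists>d. DERIV opt_logit y :> d"
proof -
  have pos: "(p - q)\<^sup>2 + 4 * p * q * exp y > 0"
    using bounds by (intro add_nonneg_pos) auto
  have "\<exists>d. DERIV opt_odds y :> d"
    unfolding opt_odds_def using bounds pos
    by (intro exI) (rule derivative_eq_intros refl | simp)+
  then obtain d where "DERIV opt_odds y :> d" ..
  from DERIV_chain2[OF DERIV_ln this, of] show ?thesis
    unfolding opt_logit_def using opt_odds_pos by blast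
qed

definition reduced_loss :: "real \<Rightarrow> real" where
  "reduced_loss y = chain_loss y (opt_logit y)"

text \<open>Stationary biases all minimize, hence give the same loss. This lets
  \<open>reduced_loss\<close> be evaluated at a convenient bias instead of the root formula.\<close>

lemma reduced_loss_eq: "stationary_bias y c \<Longrightarrow> reduced_loss y = chain_loss y c"
  unfolding reduced_loss_def
  using stationary_bias_minimizes stationary_opt_logit by (blast intro: antisym)

text \<open>Partial derivative of \<open>chain_loss\<close> in \<open>y\<close> at the optimal
  bias.\<close>

definition reduced_slope :: "real \<Rightarrow> real" where
  "reduced_slope y = p * (sigmoid (y + opt_logit y) - (1 - q)) / (p + q)"

lemma DERIV_reduced_loss: "DERIV reduced_loss y :> reduced_slope y"
proof -
  obtain d where d: "DERIV opt_logit y :> d" using opt_logit_differentiable ..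
  let ?c = "opt_logit y"
  have "DERIV (\<lambda>y. bernoulli_loss (1 - q) (y + opt_logit y)) y :> (sigmoid (y + ?c) - (1 - q)) * (1 + d)"
    by (rule DERIV_chain2[OF DERIV_bernoulli_loss]) (auto intro!: derivative_eq_intros d)
  from DERIV_cdivide[OF DERIV_add[OF DERIV_cmult[OF DERIV_chain2[OF DERIV_bernoulli_loss d], of q]
      DERIV_cmult[OF this, of p]], of p "p + q"]
  have "DERIV reduced_loss y :> (q * ((sigmoid ?c - p) * d) +
      p * ((sigmoid (y + ?c) - (1 - q)) * (1 + d))) / (p + q)"
    unfolding reduced_loss_def chain_loss_def .
  \<comment> \<open>Envelope identity: the factor of \<open>d\<close> is the first-order expression
    for the bias, which is zero.\<close>
  also have "q * ((sigmoid ?c - p) * d) + p * ((sigmoid (y + ?c) - (1 - q)) * (1 + d)) =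
      p * (sigmoid (y + ?c) - (1 - q)) + d * (q * sigmoid ?c + p * sigmoid (y + ?c) - p)"
    by (simp add: algebra_simps)
  also have "q * sigmoid ?c + p * sigmoid (y + ?c) - p = 0"
    using stationary_opt_logit[of y] by (simp add: stationary_bias_def)
  finally show ?thesis by (simp add: reduced_slope_def)
qed

section \<open>Position and depth of the valley\<close>

definition bottom :: real where
  "bottom = ln ((1 - p) * (1 - q) / (p * q))"

text \<open>\<open>bottom\<close> is the gap between the ideal scores from states 1 and 0.\<close>

lemma bottom_eq: "bottom = logit (1 - q) - logit p"
  using bounds by (simp add: bottom_def logit_def ln_mult ln_div)

lemma bottom_sign:
  "0 < bottom \<longleftrightarrow> p + q < 1" "bottom < 0 \<longleftrightarrow> 1 < p + q"
proof -
  have "0 < (1 - p) * (1 - q) / (p * q)" using bounds by simp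
  then have "0 < bottom \<longleftrightarrow> 1 < (1 - p) * (1 - q) / (p * q)"
    "bottom < 0 \<longleftrightarrow> (1 - p) * (1 - q) / (p * q) < 1"
    unfolding bottom_def by simp_all
  \<comment> \<open>The numerator exceeds the denominator by \<open>1 - p - q\<close>.\<close>
  then show "0 < bottom \<longleftrightarrow> p + q < 1" "bottom < 0 \<longleftrightarrow> 1 < p + q"
    using bounds by (auto simp: field_simps)
qed

lemma sigmoid_logits: "sigmoid (logit p) = p" "sigmoid (logit (1 - q)) = 1 - q"
  using bounds by (simp_all add: sigmoid_logit)

text \<open>By the first-order condition the prediction errors from the two states have opposite
  signs or vanish together. The score from state 1 is too low exactly when that from state 0 is too
  high, which puts their difference \<open>y\<close> below \<open>bottom\<close>; the reverse errors
  put it above.\<close>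

lemma reduced_slope_sign:
  "y < bottom \<Longrightarrow> reduced_slope y < 0"
  "bottom < y \<Longrightarrow> 0 < reduced_slope y"
proof -
  let ?c = "opt_logit y"
  have foc: "q * (sigmoid ?c - p) = - (p * (sigmoid (y + ?c) - (1 - q)))"
    using stationary_opt_logit[of y] by (simp add: stationary_bias_def algebra_simps)
  have slope: "reduced_slope y < 0 \<longleftrightarrow> sigmoid (y + ?c) < 1 - q"
      "0 < reduced_slope y \<longleftrightarrow> 1 - q < sigmoid (y + ?c)"
    using bounds
    by (simp_all add: reduced_slope_def divide_less_0_iff zero_less_divide_iff mult_less_0_iff zero_less_mult_iff)
  have iff: "sigmoid (y + ?c) < 1 - q \<longleftrightarrow> p < sigmoid ?c"
      "1 - q < sigmoid (y + ?c) \<longleftrightarrow> sigmoid ?c < p"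
  proof -
    have "0 < q * (sigmoid ?c - p) \<longleftrightarrow> p * (sigmoid (y + ?c) - (1 - q)) < 0"
         "q * (sigmoid ?c - p) < 0 \<longleftrightarrow> 0 < p * (sigmoid (y + ?c) - (1 - q))"
      unfolding foc by simp_all
    then show "sigmoid (y + ?c) < 1 - q \<longleftrightarrow> p < sigmoid ?c"
      "1 - q < sigmoid (y + ?c) \<longleftrightarrow> sigmoid ?c < p"
      using bounds by (simp_all add: mult_less_0_iff zero_less_mult_iff)
  qed
  have logits: "sigmoid (y + ?c) < 1 - q \<longleftrightarrow> y + ?c < logit (1 - q)"
    "1 - q < sigmoid (y + ?c) \<longleftrightarrow> logit (1 - q) < y + ?c"
    "p < sigmoid ?c \<longleftrightarrow> logit p < ?c" "sigmoid ?c < p \<longleftrightarrow> ?c < logit p"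
    using sigmoid_less_iff sigmoid_logits by metis+
  show "y < bottom \<Longrightarrow> reduced_slope y < 0"
    unfolding slope bottom_eq using iff logits by linarith
  show "bottom < y \<Longrightarrow> 0 < reduced_slope y"
    unfolding slope bottom_eq using iff logits by linarith
qed

text \<open>The bias \<open>logit p\<close> makes both conditional predictions exact, so each
  Bernoulli loss is an entropy.\<close>

lemma reduced_loss_bottom:
  "reduced_loss bottom = (q * binary_entropy p + p * binary_entropy q) / (p + q)"
proof -
  have eq: "bottom + logit p = logit (1 - q)" by (simp add: bottom_eq)
  have "stationary_bias bottom (logit p)"
    unfolding stationary_bias_def eq sigmoid_logits by (simp add: algebra_simps)
  then show ?thesis
    using bounds bernoulli_loss_logit[of p] bernoulli_loss_logit[of "1 - q"]
    by (simp add: reduced_loss_eq chain_loss_def eq binary_entropy_flip)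
qed

text \<open>For \<open>y = 0\<close> the score ignores the state, and the two Bernoulli losses merge
  into one for the stationary probability of a 1.\<close>

lemma reduced_loss_0: "reduced_loss 0 = binary_entropy (p / (p + q))"
proof -
  define c where "c = logit (p / (p + q))"
  have r: "0 < p / (p + q)" "p / (p + q) < 1" using bounds by simp_all
  have "stationary_bias 0 c"
    using bounds sigmoid_logit[OF r] by (simp add: stationary_bias_def c_def field_simps)
  then have "reduced_loss 0 = chain_loss 0 c" by (rule reduced_loss_eq)
  also have "\<dots> = bernoulli_loss (p / (p + q)) c"
    using bounds by (simp add: chain_loss_def bernoulli_loss_def divide_simps) (simp add: algebra_simps)
  also have "\<dots> = binary_entropy (p / (p + q))"
    unfolding c_def using r by (rule bernoulli_loss_logit)
  finally show ?thesis .
qed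

end

section \<open>Law of the chain\<close>

context stationary_binary_markov_chain
begin

lemma chain_measurable [measurable]: "1 \<le> n \<Longrightarrow> x n \<in> M \<rightarrow>\<^sub>M count_space UNIV"
  by (rule measurable_compose[OF binary, of n "\<lambda>y. y"]) simp_all

lemma chain_binary: "1 \<le> n \<Longrightarrow> \<omega> \<in> space M \<Longrightarrow> x n \<omega> = 0 \<or> x n \<omega> = 1"
  using binary[of n] by (auto dest: measurable_space)

definition joint :: "nat \<Rightarrow> real \<Rightarrow> real \<Rightarrow> real" where
  "joint n i j = \<P>(\<omega> in M. x n \<omega> = i \<and> x (n + 1) \<omega> = j)"

lemma prob_split_next:
  assumes "1 \<le> n"
  shows "\<P>(\<omega> in M. x n \<omega> = i) = joint n i 0 + joint n i 1"
proof -
  have [measurable]: "x n \<in> M \<rightarrow>\<^sub>M count_space UNIV" "x (n + 1) \<in> M \<rightarrow>\<^sub>M count_space UNIV"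
    using assms by (auto intro: chain_measurable)
  have "{\<omega>\<in>space M. x n \<omega> = i} =
      {\<omega>\<in>space M. x n \<omega> = i \<and> x (n + 1) \<omega> = 0} \<union> {\<omega>\<in>space M. x n \<omega> = i \<and> x (n + 1) \<omega> = 1}"
    using chain_binary[of "n + 1"] by auto
  then show ?thesis
    unfolding joint_def by (simp only:) (intro finite_measure_Union, measurable, auto)
qed

lemma prob_split_prev:
  assumes "1 \<le> n"
  shows "\<P>(\<omega> in M. x (n + 1) \<omega> = j) = joint n 0 j + joint n 1 j"
proof -
  have [measurable]: "x n \<in> M \<rightarrow>\<^sub>M count_space UNIV" "x (n + 1) \<in> M \<rightarrow>\<^sub>M count_space UNIV"
    using assms by (auto intro: chain_measurable)
  have "{\<omega>\<in>space M. x (n + 1) \<omega> = j} =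
      {\<omega>\<in>space M. x n \<omega> = 0 \<and> x (n + 1) \<omega> = j} \<union> {\<omega>\<in>space M. x n \<omega> = 1 \<and> x (n + 1) \<omega> = j}"
    using chain_binary[of n] assms by auto
  then show ?thesis
    unfolding joint_def by (simp only:) (intro finite_measure_Union, measurable, auto)
qed

lemma joint_switch:
  assumes "1 \<le> n"
  shows "\<P>(\<omega> in M. x n \<omega> = 0) \<noteq> 0 \<Longrightarrow> joint n 0 1 = p * \<P>(\<omega> in M. x n \<omega> = 0)"
    and "\<P>(\<omega> in M. x n \<omega> = 1) \<noteq> 0 \<Longrightarrow> joint n 1 0 = q * \<P>(\<omega> in M. x n \<omega> = 1)"
  using switch_0_1[OF assms] switch_1_0[OF assms]
  by (auto simp: cond_prob_def joint_def conj_commute field_simps)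

end

locale regular_chain = stationary_binary_markov_chain M x p q + chain_parameters p q
  for M :: "'a measure" and x :: "nat \<Rightarrow> 'a \<Rightarrow> real" and p q :: real
begin

lemma sum_nonzero: "p + q \<noteq> 0"
  using bounds by simp

text \<open>Balance: the flows \<open>joint n 0 1\<close> and \<open>joint n 1 0\<close> both equal
  \<open>p * q / (p + q)\<close>, so the marginals carry over to \<open>n + 1\<close>.\<close>

lemma stationary:
  assumes "1 \<le> n"
  shows "\<P>(\<omega> in M. x n \<omega> = 0) = q / (p + q) \<and> \<P>(\<omega> in M. x n \<omega> = 1) = p / (p + q)"
  using assms
proof (induction n rule: dec_induct)
  case base
  show ?case using init_0 init_1 by simp
next
  case (step n)
  have pi: "q / (p + q) \<noteq> 0" "p / (p + q) \<noteq> 0" using bounds by auto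
  have "joint n 0 1 = p * (q / (p + q))" "joint n 1 0 = q * (p / (p + q))"
    using joint_switch[of n] step pi by auto
  then show ?case
    using prob_split_next[of n 0] prob_split_next[of n 1] prob_split_prev[of n 0] prob_split_prev[of n 1] step
    by (simp add: mult.commute)
qed

lemma joint_eq:
  assumes "1 \<le> n"
  shows "joint n 0 0 = q * (1 - p) / (p + q)" "joint n 0 1 = q * p / (p + q)"
    "joint n 1 0 = p * q / (p + q)" "joint n 1 1 = p * (1 - q) / (p + q)"
proof -
  have pi: "q / (p + q) \<noteq> 0" "p / (p + q) \<noteq> 0" using bounds by auto
  show "joint n 0 1 = q * p / (p + q)" "joint n 1 0 = p * q / (p + q)"
    using joint_switch[OF assms] stationary[OF assms] pi by auto
  then show "joint n 0 0 = q * (1 - p) / (p + q)" "joint n 1 1 = p * (1 - q) / (p + q)"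
    using prob_split_next[OF assms, of 0] prob_split_next[OF assms, of 1] stationary[OF assms]
    by (simp_all add: right_diff_distrib diff_divide_distrib mult.commute)
qed

section \<open>Expected loss in terms of the coefficient and the bias\<close>

lemma expectation_pair:
  assumes "1 \<le> n"
  shows "(\<integral>\<omega>. f (x n \<omega>) (x (n + 1) \<omega>) \<partial>M) =
    f 0 0 * joint n 0 0 + f 0 1 * joint n 0 1 + f 1 0 * joint n 1 0 + f 1 1 * joint n 1 1"
proof -
  have [measurable]: "x n \<in> M \<rightarrow>\<^sub>M count_space UNIV" "x (n + 1) \<in> M \<rightarrow>\<^sub>M count_space UNIV"
    using assms by (auto intro: chain_measurable)
  let ?A = "\<lambda>i j. {\<omega>\<in>space M. x n \<omega> = i \<and> x (n + 1) \<omega> = j}"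
  have int: "integrable M (\<lambda>\<omega>. f i j * indicator (?A i j) \<omega>)" for i j
    by (intro integrable_mult_right integrable_real_indicator) (measurable, simp add: less_top[symmetric])
  \<comment> \<open>The pair takes four values, so the integrand is a combination of four
    indicators.\<close>
  have "(\<integral>\<omega>. f (x n \<omega>) (x (n + 1) \<omega>) \<partial>M) =
      (\<integral>\<omega>. f 0 0 * indicator (?A 0 0) \<omega> + f 0 1 * indicator (?A 0 1) \<omega>
        + f 1 0 * indicator (?A 1 0) \<omega> + f 1 1 * indicator (?A 1 1) \<omega> \<partial>M)"
  proof (rule Bochner_Integration.integral_cong[OF refl])
    fix \<omega> assume \<omega>: "\<omega> \<in> space M"
    have "x n \<omega> = 0 \<or> x n \<omega> = 1" "x (n + 1) \<omega> = 0 \<or> x (n + 1) \<omega> = 1"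
      using chain_binary \<omega> assms by auto
    then show "f (x n \<omega>) (x (n + 1) \<omega>) =
        f 0 0 * indicator (?A 0 0) \<omega> + f 0 1 * indicator (?A 0 1) \<omega>
        + f 1 0 * indicator (?A 1 0) \<omega> + f 1 1 * indicator (?A 1 1) \<omega>"
      by (elim disjE) (simp_all add: \<omega>)
  qed
  also have "\<dots> = (\<integral>\<omega>. f 0 0 * indicator (?A 0 0) \<omega> \<partial>M) + (\<integral>\<omega>. f 0 1 * indicator (?A 0 1) \<omega> \<partial>M)
      + (\<integral>\<omega>. f 1 0 * indicator (?A 1 0) \<omega> \<partial>M) + (\<integral>\<omega>. f 1 1 * indicator (?A 1 1) \<omega> \<partial>M)"
    by (simp only: Bochner_Integration.integral_add Bochner_Integration.integrable_add int)
  finally show ?thesis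
    by (simp add: joint_def)
qed

lemma bias_loss_eq:
  assumes "1 \<le> N"
  shows "bias_loss M x N (e, w) b = chain_loss (coupling (e, w)) (b - e\<^sup>2 / 2)"
proof -
  define y where "y = e\<^sup>2 * (1 + 2 * w * \<bar>w\<bar>)"
  define c where "c = b - e\<^sup>2 / 2"
  have "(\<integral>\<omega>. log_loss ((2 * x (n + 1) \<omega> - 1) * (y * x n \<omega> + c)) \<partial>M) = chain_loss y c"
    if "n \<in> {1..N}" for n
  proof -
    have n: "1 \<le> n" using that by simp
    show ?thesis
      unfolding expectation_pair[OF n, of "\<lambda>i j. log_loss ((2 * j - 1) * (y * i + c))"]
        joint_eq[OF n] chain_loss_def bernoulli_loss_def
      by (simp add: algebra_simps add_divide_distrib diff_divide_distrib)
  qed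
  then have "(\<Sum>n = 1..N. \<integral>\<omega>. log_loss ((2 * x (n + 1) \<omega> - 1) * (y * x n \<omega> + c)) \<partial>M)
    = (\<Sum>n = 1..N. chain_loss y c)"
    by (rule sum.cong[OF refl])
  \<comment> \<open>All \<open>N\<close> summands agree and \<open>N \<ge> 1\<close>, so the average
    is their common value.\<close>
  then show ?thesis
    using assms by (simp add: bias_loss_def coupling_def gain_def y_def c_def add_diff_eq)
qed

text \<open>\<open>opt_bias\<close> is an arbitrary choice among minimizers, but all minimizers
  share one value; exhibiting a single minimizer determines the loss.\<close>

lemma loss_eq:
  assumes "1 \<le> N"
  shows "loss M x N = (\<lambda>\<theta>. reduced_loss (coupling \<theta>))"
proof
  fix \<theta> :: "real \<times> real"
  obtain e w where \<theta>: "\<theta> = (e, w)" by (cases \<theta>)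
  \<comment> \<open>The summand \<open>e\<^sup>2 / 2\<close> undoes the shift in
    \<open>bias_loss_eq\<close>.\<close>
  let ?b = "opt_logit (coupling \<theta>) + e\<^sup>2 / 2"
  have min: "bias_loss M x N \<theta> ?b \<le> bias_loss M x N \<theta> b" for b
    using stationary_bias_minimizes[OF stationary_opt_logit] by (simp add: \<theta> bias_loss_eq[OF assms])
  then have "is_arg_min (bias_loss M x N \<theta>) (\<lambda>_. True) ?b"
    by (simp add: is_arg_min_linorder)
  then have "is_arg_min (bias_loss M x N \<theta>) (\<lambda>_. True) (opt_bias M x N \<theta>)"
    unfolding opt_bias_def arg_min_def by (rule someI)
  then have "loss M x N \<theta> = bias_loss M x N \<theta> ?b"
    using min by (auto simp: is_arg_min_linorder loss_def intro: antisym)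
  then show "loss M x N \<theta> = reduced_loss (coupling \<theta>)"
    by (simp add: \<theta> bias_loss_eq[OF assms] reduced_loss_def)
qed

section \<open>Entropies of the chain\<close>

lemma chain_image:
  assumes "1 \<le> n"
  shows "x n ` space M = {0, 1}" "(\<lambda>\<omega>. (x (n + 1) \<omega>, x n \<omega>)) ` space M = {0, 1} \<times> {0, 1}"
proof -
  \<comment> \<open>The entropy formulas below sum over images of the sample space, so every value
    must be attained; nonzero probability ensures it.\<close>
  have ex: "\<exists>\<omega>\<in>space M. x n \<omega> = i \<and> x (n + 1) \<omega> = j" if "joint n i j \<noteq> 0" for i j
  proof (rule ccontr)
    assume "\<not> ?thesis"
    then have "{\<omega>\<in>space M. x n \<omega> = i \<and> x (n + 1) \<omega> = j} = {}" by blast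
    then show False using that by (simp only: joint_def measure_empty simp_thms)
  qed
  have nz: "joint n 0 0 \<noteq> 0" "joint n 0 1 \<noteq> 0" "joint n 1 0 \<noteq> 0" "joint n 1 1 \<noteq> 0"
    using bounds sum_nonzero by (simp_all add: joint_eq[OF assms])
  have "(j, i) \<in> (\<lambda>\<omega>. (x (n + 1) \<omega>, x n \<omega>)) ` space M" if "joint n i j \<noteq> 0" for i j
    using ex[OF that] by force
  moreover have "(\<lambda>\<omega>. (x (n + 1) \<omega>, x n \<omega>)) ` space M \<subseteq> {0, 1} \<times> {0, 1}"
    using chain_binary[of n] chain_binary[of "n + 1"] assms by auto
  ultimately show eq: "(\<lambda>\<omega>. (x (n + 1) \<omega>, x n \<omega>)) ` space M = {0, 1} \<times> {0, 1}"
    using nz by blast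
  have "x n ` space M = snd ` (\<lambda>\<omega>. (x (n + 1) \<omega>, x n \<omega>)) ` space M"
    by (simp add: image_image)
  then show "x n ` space M = {0, 1}" unfolding eq by auto
qed

lemma simple_function_chain: "1 \<le> n \<Longrightarrow> simple_function M (x n)"
  using chain_measurable[of n] chain_image(1)[of n] by (simp add: simple_function_def)

lemma prob_singleton:
  "prob (x n -` {i} \<inter> space M) = \<P>(\<omega> in M. x n \<omega> = i)"
  by (rule arg_cong[where f = prob]) auto

lemma information_space_exp: "information_space M (exp 1)"
  by (intro information_space.intro prob_space_axioms information_space_axioms.intro) simp

lemma next_entropy_eq:
  assumes "1 \<le> n"
  shows "next_entropy M x n = binary_entropy (p / (p + q))"
proof -
  interpret information_space M "exp 1" by (rule information_space_exp)
  have n: "1 \<le> n + 1" by simp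
  have sd: "simple_distributed M (x (n + 1)) (\<lambda>i. prob (x (n + 1) -` {i} \<inter> space M))"
    by (intro simple_distributedI simple_function_chain n measure_nonneg refl)
  have "next_entropy M x n = - (\<Sum>i\<in>{0, 1}. prob (x (n + 1) -` {i} \<inter> space M) *
      log (exp 1) (prob (x (n + 1) -` {i} \<inter> space M)))"
    using entropy_simple_distributed[OF sd] by (simp only: next_entropy_def chain_image[OF n])
  also have "\<dots> = binary_entropy (p / (p + q))"
  proof -
    have "1 - p / (p + q) = q / (p + q)" using sum_nonzero by (simp add: field_simps)
    then show ?thesis
      using stationary[OF n] by (simp add: prob_singleton log_def binary_entropy_def)
  qed
  finally show ?thesis .
qed

lemma next_cond_entropy_eq:
  assumes "1 \<le> n"
  shows "next_cond_entropy M x n = (q * binary_entropy p + p * binary_entropy q) / (p + q)"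
proof -
  interpret information_space M "exp 1" by (rule information_space_exp)
  have n: "1 \<le> n + 1" by simp
  let ?Y = "\<lambda>i. prob (x n -` {i} \<inter> space M)"
  let ?XY = "\<lambda>z. prob ((\<lambda>\<omega>. (x (n + 1) \<omega>, x n \<omega>)) -` {z} \<inter> space M)"
  \<comment> \<open>The pair lists the next state first, \<open>joint\<close> the current one; hence
    the swapped indices.\<close>
  have XY: "?XY (j, i) = joint n i j" for i j
    unfolding joint_def by (rule arg_cong[where f = prob]) auto
  have sdY: "simple_distributed M (x n) ?Y"
    by (intro simple_distributedI simple_function_chain assms measure_nonneg refl)
  have sdXY: "simple_distributed M (\<lambda>\<omega>. (x (n + 1) \<omega>, x n \<omega>)) ?XY"
    by (intro simple_distributedI simple_function_Pair simple_function_chain assms n measure_nonneg refl)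
  have "next_cond_entropy M x n = - (\<Sum>(j, i)\<in>{0, 1} \<times> {0, 1}. ?XY (j, i) * log (exp 1) (?XY (j, i) / ?Y i))"
    using conditional_entropy_eq[OF sdY sdXY]
    by (simp only: next_cond_entropy_def chain_image[OF n] chain_image[OF assms])
  also have "\<dots> = - (\<Sum>j\<in>{0, 1}. \<Sum>i\<in>{0, 1}. joint n i j * ln (joint n i j / \<P>(\<omega> in M. x n \<omega> = i)))"
    unfolding XY prob_singleton by (subst sum.cartesian_product[symmetric]) (simp add: log_def)
  also have "\<dots> = - (q * (1 - p) / (p + q) * ln (1 - p) + q * p / (p + q) * ln p
      + p * q / (p + q) * ln q + p * (1 - q) / (p + q) * ln (1 - q))"
  proof -
    \<comment> \<open>Joint over marginal gives the transition probabilities. Nested quotients are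
      kept unflattened in the final simplification so that these equations match.\<close>
    have "q * (1 - p) / (p + q) / (q / (p + q)) = 1 - p" "q * p / (p + q) / (q / (p + q)) = p"
      "p * q / (p + q) / (p / (p + q)) = q" "p * (1 - q) / (p + q) / (p / (p + q)) = 1 - q"
      using bounds sum_nonzero by simp_all
    then show ?thesis
      by (simp add: joint_eq[OF assms] stationary[OF assms] del: divide_divide_eq_left divide_divide_eq_right)
  qed
  also have "\<dots> = (q * binary_entropy p + p * binary_entropy q) / (p + q)"
    by (simp add: binary_entropy_def algebra_simps add_divide_distrib diff_divide_distrib)
  finally show ?thesis .
qed

end

theorem theorem1:
  fixes M :: "'a measure" and x :: "nat \<Rightarrow> 'a \<Rightarrow> real" and p q :: real and N :: nat
  assumes "0 < p" and "p < 1" and "0 < q" and "q < 1" and "p + q \<noteq> 1"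
    and "N \<ge> 1"
    and "stationary_binary_markov_chain M x p q"
  shows "{\<theta>. global_minimum (loss M x N) \<theta>} = Theta_star p q \<and>
    {\<theta>. local_minimum (loss M x N) \<theta> \<and> \<not> global_minimum (loss M x N) \<theta>} = Theta_min p q \<and>
    {\<theta>. local_maximum (loss M x N) \<theta>} = Theta_max p q \<and>
    {\<theta>. saddle_point (loss M x N) \<theta>} = Theta_sad p q \<and>
    {\<theta>. critical_point (loss M x N) \<theta>} =
      Theta_star p q \<union> Theta_min p q \<union> Theta_max p q \<union> Theta_sad p q \<and>
    (\<forall>\<theta>star \<in> Theta_star p q. \<forall>\<theta>min \<in> Theta_min p q.
      \<forall>\<theta>max \<in> Theta_max p q. \<forall>\<theta>sad \<in> Theta_sad p q. \<forall>n\<ge>1.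
        next_cond_entropy M x n = loss M x N \<theta>star \<and>
        loss M x N \<theta>star < loss M x N \<theta>min \<and>
        loss M x N \<theta>min = loss M x N \<theta>max \<and>
        loss M x N \<theta>max = loss M x N \<theta>sad \<and>
        loss M x N \<theta>sad = next_entropy M x n)"
proof -
  interpret stationary_binary_markov_chain M x p q by fact
  interpret regular_chain M x p q by unfold_locales (use assms in auto)
  have nz: "bottom \<noteq> 0"
    using bottom_sign assms(5) by linarith
  interpret valley reduced_loss reduced_slope bottom
    by unfold_locales (use DERIV_reduced_loss reduced_slope_sign nz in auto)
  have L: "loss M x N = L" by (rule loss_eq[OF assms(6)])
  \<comment> \<open>\<open>bottom\<close> and \<open>p + q - 1\<close> have opposite signs, hence
    the reversed inequalities.\<close>
  have sign: "bottom * g < 0 \<longleftrightarrow> (p + q - 1) * g > 0" "0 < bottom * g \<longleftrightarrow> (p + q - 1) * g < 0" for g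
    using bottom_sign nz by (auto simp: mult_less_0_iff zero_less_mult_iff)
  have star: "Theta_star p q = {\<theta>. coupling \<theta> = bottom}"
    by (auto simp: Theta_star_def coupling_def gain_def bottom_def)
  have min: "Theta_min p q = {(e, w). e = 0 \<and> bottom * gain w < 0}"
    by (simp only: Theta_min_def sign gain_def)
  have max: "Theta_max p q = {(e, w). e = 0 \<and> 0 < bottom * gain w}"
    by (simp only: Theta_max_def sign gain_def)
  have sad: "Theta_sad p q = {(e, w). e = 0 \<and> gain w = 0}"
    by (auto simp: Theta_sad_def gain_eq_0_iff)
  \<comment> \<open>All three sets lie on the axis \<open>e = 0\<close>, where
    \<open>coupling\<close> is 0.\<close>
  have off_bottom: "L \<theta> = reduced_loss 0" if "\<theta> \<in> Theta_min p q \<union> Theta_max p q \<union> Theta_sad p q" for \<theta>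
    using that by (auto simp: min max sad)
  show ?thesis
    unfolding L
  proof (intro conjI ballI allI impI)
    show "{\<theta>. global_minimum L \<theta>} = Theta_star p q"
      by (simp add: star global_minimum_iff)
    show "{\<theta>. local_minimum L \<theta> \<and> \<not> global_minimum L \<theta>} = Theta_min p q"
      unfolding min using local_minimum_iff by auto
    show "{\<theta>. local_maximum L \<theta>} = Theta_max p q"
      unfolding max using local_maximum_iff by auto
    show "{\<theta>. saddle_point L \<theta>} = Theta_sad p q"
      unfolding sad using saddle_point_iff by auto
    \<comment> \<open>The sign of \<open>bottom * gain w\<close> places each axis point in one of
      the last three sets; zero means \<open>gain w = 0\<close>, as \<open>bottom\<close> is
      nonzero.\<close>
    show "{\<theta>. critical_point L \<theta>} =
        Theta_star p q \<union> Theta_min p q \<union> Theta_max p q \<union> Theta_sad p q"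
      using nz unfolding star min max sad
      by (auto simp: critical_point_iff mult_less_0_iff zero_less_mult_iff)
  next
    fix \<theta>star \<theta>min \<theta>max \<theta>sad and n :: nat
    assume \<theta>: "\<theta>star \<in> Theta_star p q" "\<theta>min \<in> Theta_min p q" "\<theta>max \<in> Theta_max p q"
      "\<theta>sad \<in> Theta_sad p q" and n: "1 \<le> n"
    show "next_cond_entropy M x n = L \<theta>star"
      using \<theta>(1) by (simp add: star next_cond_entropy_eq[OF n] reduced_loss_bottom)
    have "reduced_loss bottom < reduced_loss 0"
      using bottom_less nz by auto
    then show "L \<theta>star < L \<theta>min"
      using \<theta> off_bottom[of \<theta>min] by (simp add: star)
    show "L \<theta>min = L \<theta>max" "L \<theta>max = L \<theta>sad"
      using \<theta> off_bottom by auto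
    show "L \<theta>sad = next_entropy M x n"
      using \<theta> off_bottom[of \<theta>sad] by (simp add: next_entropy_eq[OF n] reduced_loss_0)
  qed
qed

end
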